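(* The proof system ${\bf R^\Delta}$ (regular contingency logic) is strongly complete with respect to the class of quasi-filters, i.e. the class of all neighborhood frames possessing both properties $(m)$ and $(c)$.
   Context: Fix a nonempty set $\mathbf{P}$ of propositional variables. The language $\mathcal{L}(\Delta)$ is given by $\varphi::=p\in\mathbf{P}\mid\neg\varphi\mid\varphi\land\varphi\mid\Delta\varphi$; $\vee,\to,\leftrightarrow,\top$ are the usual abbreviations. A neighborhood frame is a pair $\langle S,N\rangle$ with $S$ a nonempty set and $N:S\to\mathcal{P}(\mathcal{P}(S))$; a neighborhood model $\mathcal{M}=\langle S,N,V\rangle$ adds a valuation $V$ assigning a set $V(p)\subseteq S$ to each $p\in\mathbf{P}$. Truth: $\mathcal{M},s\vDash p$ iff $s\in V(p)$; Boolean clauses as usual; $\mathcal{M},s\vDash\Delta\varphi$ iff $\varphi^{\mathcal{M}}\in N(s)$ or $S\setminus\varphi^{\mathcal{M}}\in N(s)$, where $\varphi^{\mathcal{M}}=\{s\in S\mid\mathcal{M},s\vDash\varphi\}$. Frame properties (required for every $s\in S$): $(m)$: $X\in N(s)$ and $X\subseteq Y\subseteq S$ imply $Y\in N(s)$; $(c)$: $X,Y\in N(s)$ implies $X\cap Y\in N(s)$. The system ${\bf R^\Delta}$ has as axiom schemas all instances of propositional tautologies (TAUT), $\Delta\text{Equ}$: $\Delta\varphi\leftrightarrow\Delta\neg\varphi$, $\Delta\text{M}$: $\Delta\varphi\to\Delta(\varphi\vee\psi)\vee\Delta(\neg\varphi\vee\chi)$, and $\Delta\text{C}$: $\Delta\varphi\land\Delta\psi\to\Delta(\varphi\land\psi)$;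 its rules are MP (from $\varphi$ and $\varphi\to\psi$ infer $\psi$) and $\text{RE}\Delta$ (from $\varphi\leftrightarrow\psi$ infer $\Delta\varphi\leftrightarrow\Delta\psi$). A set $\Gamma$ of formulas is consistent in a system $\Lambda$ if there are no $\gamma_1,\dots,\gamma_n\in\Gamma$ such that $\neg(\gamma_1\land\dots\land\gamma_n)$ is a theorem of $\Lambda$. $\Lambda$ is strongly complete with respect to a class $\mathbb{K}$ of frames if every $\Lambda$-consistent set of formulas is satisfied (all members true) at some state of some model based on a frame in $\mathbb{K}$. *)

theory Defs
  imports Main
begin

text \<open>The type variable \<open>'p\<close> plays the role of the nonempty set of propositional variables.\<close>

datatype 'p fm =
    Var 'p
  | Neg "'p fm"  (\<open>\<^bold>\<not> _\<close> [70] 70)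
  | Conj "'p fm" "'p fm"  (infixr \<open>\<^bold>\<and>\<close> 65)
  | Delta "'p fm"  (\<open>\<^bold>\<Delta> _\<close> [70] 70)

abbreviation Disj :: "'p fm \<Rightarrow> 'p fm \<Rightarrow> 'p fm"  (infixr \<open>\<^bold>\<or>\<close> 60)
  where "\<phi> \<^bold>\<or> \<psi> \<equiv> \<^bold>\<not> (\<^bold>\<not> \<phi> \<^bold>\<and> \<^bold>\<not> \<psi>)"

abbreviation Imp :: "'p fm \<Rightarrow> 'p fm \<Rightarrow> 'p fm"  (infixr \<open>\<^bold>\<longrightarrow>\<close> 55)
  where "\<phi> \<^bold>\<longrightarrow> \<psi> \<equiv> \<^bold>\<not> (\<phi> \<^bold>\<and> \<^bold>\<not> \<psi>)"

abbreviation Iff :: "'p fm \<Rightarrow> 'p fm \<Rightarrow> 'p fm"  (infix \<open>\<^bold>\<longleftrightarrow>\<close> 50)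
  where "\<phi> \<^bold>\<longleftrightarrow> \<psi> \<equiv> (\<phi> \<^bold>\<longrightarrow> \<psi>) \<^bold>\<and> (\<psi> \<^bold>\<longrightarrow> \<phi>)"

record 's nframe =
  states :: "'s set"
  nbhd :: "'s \<Rightarrow> 's set set"

text \<open>Only the values of \<^const>\<open>nbhd\<close> at elements of \<^const>\<open>states\<close> are significant.\<close>

definition nbhd_frame :: "'s nframe \<Rightarrow> bool" where
  "nbhd_frame F \<longleftrightarrow> states F \<noteq> {} \<and> (\<forall>s\<in>states F. nbhd F s \<subseteq> Pow (states F))"

definition valuation :: "'s nframe \<Rightarrow> ('p \<Rightarrow> 's set) \<Rightarrow> bool" where
  "valuation F V \<longleftrightarrow> (\<forall>p. V p \<subseteq> states F)"

primrec sat :: "'s nframe \<Rightarrow> ('p \<Rightarrow> 's set) \<Rightarrow> 's \<Rightarrow> 'p fm \<Rightarrow> bool" where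
  "sat F V s (Var p) \<longleftrightarrow> s \<in> V p"
| "sat F V s (\<^bold>\<not> \<phi>) \<longleftrightarrow> \<not> sat F V s \<phi>"
| "sat F V s (\<phi> \<^bold>\<and> \<psi>) \<longleftrightarrow> sat F V s \<phi> \<and> sat F V s \<psi>"
| "sat F V s (\<^bold>\<Delta> \<phi>) \<longleftrightarrow>
     {t \<in> states F. sat F V t \<phi>} \<in> nbhd F s \<or>
     states F - {t \<in> states F. sat F V t \<phi>} \<in> nbhd F s"

definition prop_m :: "'s nframe \<Rightarrow> bool" where
  "prop_m F \<longleftrightarrow> (\<forall>s\<in>states F. \<forall>X Y. X \<in> nbhd F s \<and> X \<subseteq> Y \<and> Y \<subseteq> states F \<longrightarrow> Y \<in> nbhd F s)"

definition prop_c :: "'s nframe \<Rightarrow> bool" where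
  "prop_c F \<longleftrightarrow> (\<forall>s\<in>states F. \<forall>X Y. X \<in> nbhd F s \<and> Y \<in> nbhd F s \<longrightarrow> X \<inter> Y \<in> nbhd F s)"

definition quasi_filters :: "'s nframe set" where
  "quasi_filters = {F. nbhd_frame F \<and> prop_m F \<and> prop_c F}"

text \<open>
  Purely propositional formulas over countably many letters. Instances of propositional
  tautologies are obtained by uniformly substituting modal formulas for these letters. The letters
  are kept apart from \<open>'p\<close>, so that the stock of instances is the full one even
  if there are only finitely many propositional variables.
\<close>

datatype pl =
    Letter nat
  | PNeg pl
  | PConj pl pl

primrec pl_eval :: "(nat \<Rightarrow> bool) \<Rightarrow> pl \<Rightarrow> bool" where
  "pl_eval v (Letter i) \<longleftrightarrow> v i"
| "pl_eval v (PNeg \<alpha>) \<longleftrightarrow> \<not> pl_eval v \<alpha>"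
| "pl_eval v (PConj \<alpha> \<beta>) \<longleftrightarrow> pl_eval v \<alpha> \<and> pl_eval v \<beta>"

definition pl_tautology :: "pl \<Rightarrow> bool" where
  "pl_tautology \<alpha> \<longleftrightarrow> (\<forall>v. pl_eval v \<alpha>)"

primrec pl_subst :: "(nat \<Rightarrow> 'p fm) \<Rightarrow> pl \<Rightarrow> 'p fm" where
  "pl_subst \<sigma> (Letter i) = \<sigma> i"
| "pl_subst \<sigma> (PNeg \<alpha>) = \<^bold>\<not> pl_subst \<sigma> \<alpha>"
| "pl_subst \<sigma> (PConj \<alpha> \<beta>) = pl_subst \<sigma> \<alpha> \<^bold>\<and> pl_subst \<sigma> \<beta>"

inductive_set R_Delta :: "'p fm set" where
  TAUT: "pl_tautology \<alpha> \<Longrightarrow> pl_subst \<sigma> \<alpha> \<in> R_Delta"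
| Delta_Equ: "(\<^bold>\<Delta> \<phi> \<^bold>\<longleftrightarrow> \<^bold>\<Delta> (\<^bold>\<not> \<phi>)) \<in> R_Delta"
| Delta_M: "(\<^bold>\<Delta> \<phi> \<^bold>\<longrightarrow> \<^bold>\<Delta> (\<phi> \<^bold>\<or> \<psi>) \<^bold>\<or> \<^bold>\<Delta> (\<^bold>\<not> \<phi> \<^bold>\<or> \<chi>)) \<in> R_Delta"
| Delta_C: "(\<^bold>\<Delta> \<phi> \<^bold>\<and> \<^bold>\<Delta> \<psi> \<^bold>\<longrightarrow> \<^bold>\<Delta> (\<phi> \<^bold>\<and> \<psi>)) \<in> R_Delta"
| MP: "\<phi> \<in> R_Delta \<Longrightarrow> (\<phi> \<^bold>\<longrightarrow> \<psi>) \<in> R_Delta \<Longrightarrow> \<psi> \<in> R_Delta"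
| RE_Delta: "(\<phi> \<^bold>\<longleftrightarrow> \<psi>) \<in> R_Delta \<Longrightarrow> (\<^bold>\<Delta> \<phi> \<^bold>\<longleftrightarrow> \<^bold>\<Delta> \<psi>) \<in> R_Delta"

text \<open>\<open>conj_list \<gamma>\<^sub>1 [\<gamma>\<^sub>2, \<dots>, \<gamma>\<^sub>n]\<close> is the conjunction of \<open>n \<ge> 1\<close> formulas.\<close>

fun conj_list :: "'p fm \<Rightarrow> 'p fm list \<Rightarrow> 'p fm" where
  "conj_list \<gamma> [] = \<gamma>"
| "conj_list \<gamma> (\<delta> # \<delta>s) = \<gamma> \<^bold>\<and> conj_list \<delta> \<delta>s"

text \<open>A system is represented by its set of theorems.\<close>

definition consistent :: "'p fm set \<Rightarrow> 'p fm set \<Rightarrow> bool" where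
  "consistent \<Lambda> \<Gamma> \<longleftrightarrow>
     \<not> (\<exists>\<gamma> \<gamma>s. set (\<gamma> # \<gamma>s) \<subseteq> \<Gamma> \<and> (\<^bold>\<not> (conj_list \<gamma> \<gamma>s)) \<in> \<Lambda>)"

text \<open>
  HOL cannot quantify over types inside a formula, so the states of the frames in \<open>K\<close> are drawn
  from a fixed type \<open>'s\<close>; a frame's set of states may be any nonempty subset of it.
\<close>

definition strongly_complete :: "'p fm set \<Rightarrow> 's nframe set \<Rightarrow> bool" where
  "strongly_complete \<Lambda> K \<longleftrightarrow>
     (\<forall>\<Gamma>. consistent \<Lambda> \<Gamma> \<longrightarrow>
       (\<exists>F\<in>K. \<exists>V. valuation F V \<and> (\<exists>s\<in>states F. \<forall>\<phi>\<in>\<Gamma>. sat F V s \<phi>)))"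

end

theory Submission
  imports Defs
begin

text \<open>
  The proof uses a canonical model whose states are the maximal consistent sets. Since \<open>\<Delta>\<phi>\<close> says
  only that \<open>\<phi>\<close> or its negation is a neighborhood, without saying which one, a state \<open>s\<close> does not
  determine its neighborhoods outright. Selecting every \<open>\<phi>\<close> with \<open>\<Delta>\<phi> \<in> s\<close>
  would select \<open>\<not>\<phi>\<close> along with \<open>\<phi>\<close>, but in a quasi-filter a state
  that has a set and its complement as neighborhoods has every set as a neighborhood. The idea is to
  declare \<open>\<phi>\<close> a neighborhood when \<open>\<Delta>\<close> holds at everything weaker:
  \<open>\<Delta>(\<phi> \<or> \<psi>) \<in> s\<close> for all \<open>\<psi>\<close>.

  The set of formulas so selected is closed under weakening by its very shape. It is closed under
  conjunction by \<open>\<Delta>C\<close>, because \<open>(\<phi> \<and> \<psi>) \<or> \<chi>\<close> is equivalent to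
  \<open>(\<phi> \<or> \<chi>) \<and> (\<psi> \<or> \<chi>)\<close>. And \<open>\<Delta>M\<close> is exactly the statement that
  \<open>\<Delta>\<phi> \<in> s\<close> forces \<open>\<phi>\<close> or \<open>\<not>\<phi>\<close> to be selected, since
  counterexamples \<open>\<psi>\<close> and \<open>\<chi>\<close> to both would refute it; the converse is \<open>\<Delta>Equ\<close>.
  Closing the truth sets of the selected formulas under supersets therefore yields a quasi-filter,
  and the Truth Lemma follows: a selected formula whose truth set is included in that of \<open>\<phi>\<close>
  provably implies \<open>\<phi>\<close>, so that \<open>\<phi>\<close> is selected as well.

  Propositional reasoning inside the calculus is carried out semantically. A formula that is true
  under every assignment respecting negation and conjunction is a theorem, and, by Lindenbaum's
  lemma, so is a formula that belongs to every maximal consistent set.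
\<close>

section \<open>Tautological reasoning in the calculus\<close>

text \<open>
  A Boolean set is a truth assignment to all formulas, given as the set of formulas made true, that
  treats variables and \<open>\<Delta>\<close>-formulas alike as atoms.
\<close>

definition boolean :: "'p fm set \<Rightarrow> bool" where
  "boolean w \<longleftrightarrow>
     (\<forall>\<phi>. (\<^bold>\<not> \<phi>) \<in> w \<longleftrightarrow> \<phi> \<notin> w) \<and>
     (\<forall>\<phi> \<psi>. (\<phi> \<^bold>\<and> \<psi>) \<in> w \<longleftrightarrow> \<phi> \<in> w \<and> \<psi> \<in> w)"

lemma boolean_Neg: "boolean w \<Longrightarrow> (\<^bold>\<not> \<phi>) \<in> w \<longleftrightarrow> \<phi> \<notin> w"
  and boolean_Conj: "boolean w \<Longrightarrow> (\<phi> \<^bold>\<and> \<psi>) \<in> w \<longleftrightarrow> \<phi> \<in> w \<and> \<psi> \<in> w"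
  by (simp_all add: boolean_def)

lemmas boolean_simps = boolean_Neg boolean_Conj

primrec atoms :: "'p fm \<Rightarrow> 'p fm set" where
  "atoms (Var p) = {Var p}"
| "atoms (\<^bold>\<not> \<phi>) = atoms \<phi>"
| "atoms (\<phi> \<^bold>\<and> \<psi>) = atoms \<phi> \<union> atoms \<psi>"
| "atoms (\<^bold>\<Delta> \<phi>) = {\<^bold>\<Delta> \<phi>}"

primrec skeleton :: "('p fm \<Rightarrow> nat) \<Rightarrow> 'p fm \<Rightarrow> pl" where
  "skeleton f (Var p) = Letter (f (Var p))"
| "skeleton f (\<^bold>\<not> \<phi>) = PNeg (skeleton f \<phi>)"
| "skeleton f (\<phi> \<^bold>\<and> \<psi>) = PConj (skeleton f \<phi>) (skeleton f \<psi>)"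
| "skeleton f (\<^bold>\<Delta> \<phi>) = Letter (f (\<^bold>\<Delta> \<phi>))"

lemma finite_atoms: "finite (atoms \<phi>)"
  by (induction \<phi>) auto

lemma pl_subst_skeleton:
  assumes "\<And>\<alpha>. \<alpha> \<in> atoms \<phi> \<Longrightarrow> \<sigma> (f \<alpha>) = \<alpha>"
  shows "pl_subst \<sigma> (skeleton f \<phi>) = \<phi>"
  using assms by (induction \<phi>) auto

lemma boolean_skeleton: "boolean {\<phi>. pl_eval v (skeleton f \<phi>)}"
  by (simp add: boolean_def)

text \<open>
  There may be uncountably many formulas but only countably many letters. Hence the letters are
  assigned to the finitely many atoms of the one formula under consideration.
\<close>

lemma tautology_in_R_Delta:
  assumes "\<And>w. boolean w \<Longrightarrow> \<phi> \<in> w"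
  shows "\<phi> \<in> R_Delta"
proof -
  obtain f :: "'a fm \<Rightarrow> nat" where inj: "inj_on f (atoms \<phi>)"
    using finite_imp_inj_to_nat_seg[OF finite_atoms] by blast
  have "pl_tautology (skeleton f \<phi>)"
    using assms[OF boolean_skeleton] by (simp add: pl_tautology_def)
  then have "pl_subst (inv_into (atoms \<phi>) f) (skeleton f \<phi>) \<in> R_Delta"
    by (rule TAUT)
  moreover have "pl_subst (inv_into (atoms \<phi>) f) (skeleton f \<phi>) = \<phi>"
    by (rule pl_subst_skeleton) (simp add: inj)
  ultimately show ?thesis by simp
qed

lemma R_Delta_consequence:
  assumes "\<phi> \<in> R_Delta" and "\<And>w. boolean w \<Longrightarrow> \<phi> \<in> w \<Longrightarrow> \<psi> \<in> w"
  shows "\<psi> \<in> R_Delta"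
proof -
  have "(\<phi> \<^bold>\<longrightarrow> \<psi>) \<in> R_Delta"
    by (rule tautology_in_R_Delta) (use assms(2) in \<open>auto simp: boolean_simps\<close>)
  with assms(1) show ?thesis by (rule MP)
qed

lemma R_Delta_consequence2:
  assumes "\<phi> \<in> R_Delta" and "\<psi> \<in> R_Delta"
    and "\<And>w. boolean w \<Longrightarrow> \<phi> \<in> w \<Longrightarrow> \<psi> \<in> w \<Longrightarrow> \<chi> \<in> w"
  shows "\<chi> \<in> R_Delta"
proof -
  have "(\<psi> \<^bold>\<longrightarrow> \<chi>) \<in> R_Delta"
    by (rule R_Delta_consequence[OF assms(1)]) (use assms(3) in \<open>auto simp: boolean_simps\<close>)
  with assms(2) show ?thesis by (rule MP)
qed

lemma boolean_conj_list:
  "boolean w \<Longrightarrow> conj_list \<gamma> \<gamma>s \<in> w \<longleftrightarrow> set (\<gamma> # \<gamma>s) \<subseteq> w"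
  by (induction \<gamma> \<gamma>s rule: conj_list.induct) (auto simp: boolean_simps)

section \<open>Lindenbaum's lemma\<close>

text \<open>
  The maximal consistent sets, described by the closure properties that the canonical model uses.
\<close>

definition worlds :: "'p fm set set" where
  "worlds = {w. boolean w \<and> R_Delta \<subseteq> w}"

text \<open>
  Consistency is a property of finite nonempty lists, and a list inside the union of a chain already
  lies inside a member of the chain.
\<close>

lemma consistent_Union_chain:
  assumes chain: "subset.chain {M. consistent \<Lambda> M} C" and "C \<noteq> {}"
  shows "consistent \<Lambda> (\<Union>C)"
  unfolding consistent_def
proof safe
  fix \<gamma> \<gamma>s
  assume sub: "set (\<gamma> # \<gamma>s) \<subseteq> \<Union>C" and refuted: "(\<^bold>\<not> (conj_list \<gamma> \<gamma>s)) \<in> \<Lambda>"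
  obtain M where "M \<in> C" "set (\<gamma> # \<gamma>s) \<subseteq> M"
    using finite_subset_Union_chain[OF finite_set sub \<open>C \<noteq> {}\<close> chain] .
  moreover from chain \<open>M \<in> C\<close> have "consistent \<Lambda> M"
    by (auto simp: subset.chain_def)
  ultimately show False
    using refuted unfolding consistent_def by blast
qed

text \<open>
  Being inconsistent is witnessed by a nonempty list, so the empty set counts as consistent. A
  nonempty set is needed here to provide the first conjunct of a refutation.
\<close>

lemma consistent_no_tautological_conflict:
  assumes "consistent R_Delta M" and "M \<noteq> {}" and "set \<gamma>s \<subseteq> M" and "\<theta> \<in> R_Delta"
    and conflict: "\<And>w. boolean w \<Longrightarrow> \<theta> \<in> w \<Longrightarrow> \<not> set \<gamma>s \<subseteq> w"
  shows False
proof -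
  from \<open>M \<noteq> {}\<close> obtain \<mu> where "\<mu> \<in> M" by blast
  have "(\<^bold>\<not> (conj_list \<mu> \<gamma>s)) \<in> R_Delta"
    by (rule R_Delta_consequence[OF \<open>\<theta> \<in> R_Delta\<close>])
      (use conflict in \<open>auto simp: boolean_Neg boolean_conj_list\<close>)
  moreover have "set (\<mu> # \<gamma>s) \<subseteq> M"
    using \<open>\<mu> \<in> M\<close> \<open>set \<gamma>s \<subseteq> M\<close> by simp
  ultimately show False
    using \<open>consistent R_Delta M\<close> unfolding consistent_def by blast
qed

text \<open>
  Zorn's lemma provides a maximal consistent extension. Were both \<open>\<phi>\<close> and \<open>\<not>\<phi>\<close> missing
  from it, their two refutations would combine into one that uses only members of the extension.
\<close>

lemma Lindenbaum:
  assumes "consistent R_Delta \<Gamma>" and "\<Gamma> \<noteq> {}"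
  obtains w where "w \<in> worlds" "\<Gamma> \<subseteq> w"
proof -
  let ?A = "{M. consistent R_Delta M \<and> \<Gamma> \<subseteq> M}"
  have "\<exists>U\<in>?A. \<forall>X\<in>C. X \<subseteq> U" if "subset.chain ?A C" for C
  proof (cases "C = {}")
    case True
    then show ?thesis using assms(1) by blast
  next
    case False
    from that have "subset.chain {M. consistent R_Delta M} C"
      by (auto simp: subset.chain_def)
    then have "consistent R_Delta (\<Union>C)"
      using False by (rule consistent_Union_chain)
    moreover have "\<Gamma> \<subseteq> \<Union>C"
      using that False unfolding subset.chain_def by blast
    ultimately show ?thesis by (intro bexI[of _ "\<Union>C"]) auto
  qed
  then have "\<exists>M\<in>?A. \<forall>X\<in>?A. M \<subseteq> X \<longrightarrow> X = M"
    by (rule subset_Zorn)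
  then obtain M where "M \<in> ?A" and max_in: "\<forall>X\<in>?A. M \<subseteq> X \<longrightarrow> X = M"
    by (rule bexE)
  then have M: "consistent R_Delta M" "\<Gamma> \<subseteq> M" by simp_all
  then have max: "X = M" if "consistent R_Delta X" "M \<subseteq> X" for X
    using max_in that M(2) by (simp add: subset_trans[of \<Gamma> M X])
  have "M \<noteq> {}" using M(2) assms(2) by blast
  note no_conflict = consistent_no_tautological_conflict[OF M(1) \<open>M \<noteq> {}\<close>]

  \<comment> \<open>By maximality, adding a missing formula to \<open>M\<close> creates a refutation. The rest of that
      refutation lies in \<open>M\<close> and excludes the formula on tautological grounds.\<close>
  have refutation: "\<exists>\<gamma>s \<theta>. set \<gamma>s \<subseteq> M \<and> \<theta> \<in> R_Delta \<and>
      (\<forall>w. boolean w \<longrightarrow> \<theta> \<in> w \<longrightarrow> set \<gamma>s \<subseteq> w \<longrightarrow> \<phi> \<notin> w)"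
    if "\<phi> \<notin> M" for \<phi>
  proof -
    have "\<not> consistent R_Delta (insert \<phi> M)"
      using max[of "insert \<phi> M"] that by blast
    then obtain \<gamma> \<gamma>s where *: "set (\<gamma> # \<gamma>s) \<subseteq> insert \<phi> M" "(\<^bold>\<not> (conj_list \<gamma> \<gamma>s)) \<in> R_Delta"
      unfolding consistent_def by blast
    show ?thesis
    proof (intro exI conjI allI impI)
      show "set (removeAll \<phi> (\<gamma> # \<gamma>s)) \<subseteq> M"
        using *(1) by auto
      show "(\<^bold>\<not> (conj_list \<gamma> \<gamma>s)) \<in> R_Delta" by (fact *(2))
      show "\<phi> \<notin> w" if "boolean w" "(\<^bold>\<not> (conj_list \<gamma> \<gamma>s)) \<in> w" "set (removeAll \<phi> (\<gamma> # \<gamma>s)) \<subseteq> w" for w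
      proof
        assume "\<phi> \<in> w"
        with that(3) have "set (\<gamma> # \<gamma>s) \<subseteq> w"
          by (auto split: if_splits)
        with that(1,2) show False
          by (simp add: boolean_Neg boolean_conj_list)
      qed
    qed
  qed

  have complete: "\<phi> \<in> M \<or> (\<^bold>\<not> \<phi>) \<in> M" for \<phi>
  proof (rule ccontr)
    assume "\<not> ?thesis"
    then have "\<phi> \<notin> M" "(\<^bold>\<not> \<phi>) \<notin> M" by auto
    from refutation[OF this(1)] refutation[OF this(2)]
    obtain \<gamma>s \<theta> \<delta>s \<eta> where
      1: "set \<gamma>s \<subseteq> M" "\<theta> \<in> R_Delta"
         "\<And>w. boolean w \<Longrightarrow> \<theta> \<in> w \<Longrightarrow> set \<gamma>s \<subseteq> w \<Longrightarrow> \<phi> \<notin> w" and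
      2: "set \<delta>s \<subseteq> M" "\<eta> \<in> R_Delta"
         "\<And>w. boolean w \<Longrightarrow> \<eta> \<in> w \<Longrightarrow> set \<delta>s \<subseteq> w \<Longrightarrow> (\<^bold>\<not> \<phi>) \<notin> w"
      by metis
    have "(\<theta> \<^bold>\<and> \<eta>) \<in> R_Delta"
      by (rule R_Delta_consequence2[OF 1(2) 2(2)]) (simp add: boolean_simps)
    then show False
      by (rule no_conflict[of "\<gamma>s @ \<delta>s", rotated])
        (use 1 2 in \<open>auto simp: boolean_simps\<close>)
  qed
  have closed: "\<psi> \<in> M"
    if "set \<gamma>s \<subseteq> M" "\<theta> \<in> R_Delta" "\<And>w. boolean w \<Longrightarrow> \<theta> \<in> w \<Longrightarrow> set \<gamma>s \<subseteq> w \<Longrightarrow> \<psi> \<in> w"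
    for \<gamma>s \<theta> \<psi>
  proof (rule ccontr)
    assume "\<psi> \<notin> M"
    with complete have "(\<^bold>\<not> \<psi>) \<in> M" by blast
    then show False
      using that by (intro no_conflict[of "(\<^bold>\<not> \<psi>) # \<gamma>s" \<theta>]) (auto simp: boolean_simps)
  qed
  \<comment> \<open>Some theorem is needed where \<open>no_conflict\<close> and \<open>closed\<close> ask for one.\<close>
  obtain \<tau> :: "'a fm" where \<tau>: "\<tau> \<in> R_Delta" using Delta_Equ by blast
  have "boolean M"
    unfolding boolean_def
  proof (intro conjI allI)
    fix \<phi> \<psi>
    have "\<not> (\<phi> \<in> M \<and> (\<^bold>\<not> \<phi>) \<in> M)"
      using no_conflict[of "[\<phi>, \<^bold>\<not> \<phi>]", OF _ \<tau>] by (auto simp: boolean_simps)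
    with complete show "(\<^bold>\<not> \<phi>) \<in> M \<longleftrightarrow> \<phi> \<notin> M" by blast
    show "(\<phi> \<^bold>\<and> \<psi>) \<in> M \<longleftrightarrow> \<phi> \<in> M \<and> \<psi> \<in> M"
    proof (intro iffI conjI)
      assume "(\<phi> \<^bold>\<and> \<psi>) \<in> M"
      then show "\<phi> \<in> M" "\<psi> \<in> M"
        by (intro closed[of "[\<phi> \<^bold>\<and> \<psi>]" \<tau>]; simp add: boolean_simps \<tau>)+
    next
      assume "\<phi> \<in> M \<and> \<psi> \<in> M"
      then show "(\<phi> \<^bold>\<and> \<psi>) \<in> M"
        by (intro closed[of "[\<phi>, \<psi>]" \<tau>]) (simp_all add: boolean_simps \<tau>)
    qed
  qed
  moreover have "R_Delta \<subseteq> M"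
    using closed[of "[]"] by auto
  ultimately show thesis
    using M(2) that by (auto simp: worlds_def)
qed

lemma theorem_if_in_all_worlds:
  assumes "\<And>w. w \<in> worlds \<Longrightarrow> \<phi> \<in> w"
  shows "\<phi> \<in> R_Delta"
proof -
  have "\<not> consistent R_Delta {\<^bold>\<not> \<phi>}"
  proof
    assume "consistent R_Delta {\<^bold>\<not> \<phi>}"
    then obtain w where "w \<in> worlds" "{\<^bold>\<not> \<phi>} \<subseteq> w"
      by (rule Lindenbaum) simp
    with assms[of w] show False
      by (simp add: worlds_def boolean_Neg)
  qed
  then obtain \<gamma> \<gamma>s where *: "set (\<gamma> # \<gamma>s) \<subseteq> {\<^bold>\<not> \<phi>}" "(\<^bold>\<not> (conj_list \<gamma> \<gamma>s)) \<in> R_Delta"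
    unfolding consistent_def by blast
  from *(2) show ?thesis
    by (rule R_Delta_consequence) (use *(1) in \<open>auto simp: boolean_Neg boolean_conj_list\<close>)
qed

section \<open>The neighborhood formulas of a maximal consistent set\<close>

definition truth_set :: "'p fm \<Rightarrow> 'p fm set set" where
  "truth_set \<phi> = {w \<in> worlds. \<phi> \<in> w}"

lemma truth_set_Neg: "truth_set (\<^bold>\<not> \<phi>) = worlds - truth_set \<phi>"
  and truth_set_Conj: "truth_set (\<phi> \<^bold>\<and> \<psi>) = truth_set \<phi> \<inter> truth_set \<psi>"
  and truth_set_subset_worlds: "truth_set \<phi> \<subseteq> worlds"
  by (auto simp: truth_set_def worlds_def boolean_simps)

lemmas truth_set_simps = truth_set_Neg truth_set_Conj

text \<open>
  Equal truth sets amount to provable equivalence, so this is how \<open>RE\<Delta>\<close> enters: every later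
  rewriting under \<open>\<Delta>\<close> is a computation with sets.
\<close>

lemma Delta_cong:
  assumes "s \<in> worlds" and "truth_set \<phi> = truth_set \<psi>"
  shows "(\<^bold>\<Delta> \<phi>) \<in> s \<longleftrightarrow> (\<^bold>\<Delta> \<psi>) \<in> s"
proof -
  have "(\<phi> \<^bold>\<longleftrightarrow> \<psi>) \<in> R_Delta"
  proof (rule theorem_if_in_all_worlds)
    fix w :: "'a fm set"
    assume "w \<in> worlds"
    moreover from this have "\<phi> \<in> w \<longleftrightarrow> \<psi> \<in> w"
      using assms(2) by (auto simp: truth_set_def)
    ultimately show "(\<phi> \<^bold>\<longleftrightarrow> \<psi>) \<in> w"
      by (simp add: worlds_def boolean_simps)
  qed
  then have "(\<^bold>\<Delta> \<phi> \<^bold>\<longleftrightarrow> \<^bold>\<Delta> \<psi>) \<in> s"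
    using RE_Delta assms(1) by (auto simp: worlds_def)
  with assms(1) show ?thesis
    by (auto simp: worlds_def boolean_simps)
qed

definition nbhd_formulas :: "'p fm set \<Rightarrow> 'p fm set" where
  "nbhd_formulas s = {\<phi>. \<forall>\<psi>. (\<^bold>\<Delta> (\<phi> \<^bold>\<or> \<psi>)) \<in> s}"

text \<open>
  If \<open>\<phi>\<close> implies \<open>\<psi>\<close>, then \<open>\<psi> \<or> \<chi>\<close> is equivalent to
  \<open>\<phi> \<or> (\<psi> \<or> \<chi>)\<close>.
\<close>

lemma nbhd_formulas_mono:
  assumes "s \<in> worlds" and "\<phi> \<in> nbhd_formulas s" and "truth_set \<phi> \<subseteq> truth_set \<psi>"
  shows "\<psi> \<in> nbhd_formulas s"
proof -
  have "(\<^bold>\<Delta> (\<psi> \<^bold>\<or> \<chi>)) \<in> s" for \<chi>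
  proof -
    have "truth_set (\<psi> \<^bold>\<or> \<chi>) = truth_set (\<phi> \<^bold>\<or> (\<psi> \<^bold>\<or> \<chi>))"
      using assms(3) truth_set_subset_worlds by (auto simp: truth_set_simps)
    moreover have "(\<^bold>\<Delta> (\<phi> \<^bold>\<or> (\<psi> \<^bold>\<or> \<chi>))) \<in> s"
      using assms(2) by (simp add: nbhd_formulas_def)
    ultimately show ?thesis
      using Delta_cong[OF assms(1)] by blast
  qed
  then show ?thesis by (simp add: nbhd_formulas_def)
qed

lemma nbhd_formulas_Conj:
  assumes "s \<in> worlds" and "\<phi> \<in> nbhd_formulas s" and "\<psi> \<in> nbhd_formulas s"
  shows "(\<phi> \<^bold>\<and> \<psi>) \<in> nbhd_formulas s"
proof -
  have "(\<^bold>\<Delta> ((\<phi> \<^bold>\<and> \<psi>) \<^bold>\<or> \<chi>)) \<in> s" for \<chi>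
  proof -
    have "(\<^bold>\<Delta> (\<phi> \<^bold>\<or> \<chi>)) \<in> s" "(\<^bold>\<Delta> (\<psi> \<^bold>\<or> \<chi>)) \<in> s"
      using assms(2,3) by (simp_all add: nbhd_formulas_def)
    moreover have "(\<^bold>\<Delta> (\<phi> \<^bold>\<or> \<chi>) \<^bold>\<and> \<^bold>\<Delta> (\<psi> \<^bold>\<or> \<chi>) \<^bold>\<longrightarrow> \<^bold>\<Delta> ((\<phi> \<^bold>\<or> \<chi>) \<^bold>\<and> (\<psi> \<^bold>\<or> \<chi>))) \<in> s"
      using assms(1) Delta_C by (auto simp: worlds_def)
    ultimately have "(\<^bold>\<Delta> ((\<phi> \<^bold>\<or> \<chi>) \<^bold>\<and> (\<psi> \<^bold>\<or> \<chi>))) \<in> s"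
      using assms(1) by (simp add: worlds_def boolean_simps)
    moreover have "truth_set ((\<phi> \<^bold>\<or> \<chi>) \<^bold>\<and> (\<psi> \<^bold>\<or> \<chi>)) = truth_set ((\<phi> \<^bold>\<and> \<psi>) \<^bold>\<or> \<chi>)"
      by (auto simp: truth_set_simps)
    ultimately show ?thesis
      using Delta_cong[OF assms(1)] by blast
  qed
  then show ?thesis by (simp add: nbhd_formulas_def)
qed

text \<open>
  This is where \<open>\<Delta>M\<close> is tailored to the definition: if neither \<open>\<phi>\<close> nor \<open>\<not>\<phi>\<close> were selected,
  the two formulas witnessing this would instantiate \<open>\<psi>\<close> and \<open>\<chi>\<close> in the axiom. Conversely,
  a selected formula can be weakened by itself.
\<close>

lemma Delta_in_world_iff:
  assumes "s \<in> worlds"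
  shows "(\<^bold>\<Delta> \<phi>) \<in> s \<longleftrightarrow> \<phi> \<in> nbhd_formulas s \<or> (\<^bold>\<not> \<phi>) \<in> nbhd_formulas s"
proof
  assume "(\<^bold>\<Delta> \<phi>) \<in> s"
  have "(\<^bold>\<Delta> (\<phi> \<^bold>\<or> \<psi>)) \<in> s \<or> (\<^bold>\<Delta> (\<^bold>\<not> \<phi> \<^bold>\<or> \<chi>)) \<in> s" for \<psi> \<chi>
  proof -
    have "(\<^bold>\<Delta> \<phi> \<^bold>\<longrightarrow> \<^bold>\<Delta> (\<phi> \<^bold>\<or> \<psi>) \<^bold>\<or> \<^bold>\<Delta> (\<^bold>\<not> \<phi> \<^bold>\<or> \<chi>)) \<in> s"
      using assms Delta_M by (auto simp: worlds_def)
    with \<open>(\<^bold>\<Delta> \<phi>) \<in> s\<close> assms show ?thesis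
      by (auto simp: worlds_def boolean_simps)
  qed
  then show "\<phi> \<in> nbhd_formulas s \<or> (\<^bold>\<not> \<phi>) \<in> nbhd_formulas s"
    unfolding nbhd_formulas_def by blast
next
  have self: "(\<^bold>\<Delta> \<psi>) \<in> s" if "\<psi> \<in> nbhd_formulas s" for \<psi>
  proof -
    have "(\<^bold>\<Delta> (\<psi> \<^bold>\<or> \<psi>)) \<in> s"
      using that by (simp add: nbhd_formulas_def)
    moreover have "truth_set (\<psi> \<^bold>\<or> \<psi>) = truth_set \<psi>"
      using truth_set_subset_worlds by (auto simp: truth_set_simps)
    ultimately show ?thesis
      using Delta_cong[OF assms] by blast
  qed
  have "(\<^bold>\<Delta> \<phi> \<^bold>\<longleftrightarrow> \<^bold>\<Delta> (\<^bold>\<not> \<phi>)) \<in> s"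
    using assms Delta_Equ by (auto simp: worlds_def)
  then have "(\<^bold>\<Delta> \<phi>) \<in> s \<longleftrightarrow> (\<^bold>\<Delta> (\<^bold>\<not> \<phi>)) \<in> s"
    using assms by (auto simp: worlds_def boolean_simps)
  then show "(\<^bold>\<Delta> \<phi>) \<in> s" if "\<phi> \<in> nbhd_formulas s \<or> (\<^bold>\<not> \<phi>) \<in> nbhd_formulas s"
    using self that by blast
qed

section \<open>The canonical model\<close>

text \<open>
  Not every set of states is the truth set of a formula, so the truth sets of the selected formulas
  have to be closed under supersets explicitly.
\<close>

definition canonical_frame :: "'p fm set nframe" where
  "canonical_frame =
     \<lparr>states = worlds,
      nbhd = \<lambda>s. {X. X \<subseteq> worlds \<and> (\<exists>\<phi>\<in>nbhd_formulas s. truth_set \<phi> \<subseteq> X)}\<rparr>"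

definition canonical_valuation :: "'p \<Rightarrow> 'p fm set set" where
  "canonical_valuation p = truth_set (Var p)"

text \<open>
  The superset closure adds no truth sets of new formulas, because the selected formulas are already
  closed under weakening.
\<close>

lemma truth_set_in_canonical_nbhd:
  assumes "s \<in> worlds"
  shows "truth_set \<phi> \<in> nbhd canonical_frame s \<longleftrightarrow> \<phi> \<in> nbhd_formulas s"
  using nbhd_formulas_mono[OF assms] truth_set_subset_worlds
  by (auto simp: canonical_frame_def)

lemma canonical_frame_quasi_filter:
  assumes "(worlds :: 'p fm set set) \<noteq> {}"
  shows "(canonical_frame :: 'p fm set nframe) \<in> quasi_filters"
proof -
  let ?F = "canonical_frame :: 'p fm set nframe"
  have "nbhd_frame ?F"
    using assms by (auto simp: nbhd_frame_def canonical_frame_def)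
  moreover have "prop_m ?F"
    unfolding prop_m_def canonical_frame_def by (auto 4 3)
  moreover have "prop_c ?F"
    unfolding prop_c_def
  proof (intro ballI allI impI)
    fix s :: "'p fm set" and X Y
    assume s: "s \<in> states ?F" and "X \<in> nbhd ?F s \<and> Y \<in> nbhd ?F s"
    then obtain \<phi> \<psi> where
      "X \<subseteq> worlds" "\<phi> \<in> nbhd_formulas s" "truth_set \<phi> \<subseteq> X" "\<psi> \<in> nbhd_formulas s" "truth_set \<psi> \<subseteq> Y"
      by (auto simp: canonical_frame_def)
    moreover have "(\<phi> \<^bold>\<and> \<psi>) \<in> nbhd_formulas s"
      using s calculation nbhd_formulas_Conj by (simp add: canonical_frame_def)
    moreover have "truth_set (\<phi> \<^bold>\<and> \<psi>) \<subseteq> X \<inter> Y"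
      using calculation by (auto simp: truth_set_Conj)
    ultimately show "X \<inter> Y \<in> nbhd ?F s"
      by (auto simp: canonical_frame_def)
  qed
  ultimately show ?thesis
    by (simp add: quasi_filters_def)
qed

lemma truth_lemma:
  assumes "s \<in> worlds"
  shows "sat canonical_frame canonical_valuation s \<phi> \<longleftrightarrow> \<phi> \<in> s"
  using assms
proof (induction \<phi> arbitrary: s)
  case (Var p)
  then show ?case by (simp add: canonical_valuation_def truth_set_def)
next
  case (Neg \<phi>)
  then show ?case by (simp add: worlds_def boolean_Neg)
next
  case (Conj \<phi> \<psi>)
  then show ?case by (simp add: worlds_def boolean_Conj)
next
  case (Delta \<phi>)
  have states: "states canonical_frame = worlds"
    by (simp add: canonical_frame_def)
  have "{t \<in> states canonical_frame. sat canonical_frame canonical_valuation t \<phi>} = truth_set \<phi>"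
    using Delta.IH by (auto simp: states truth_set_def)
  moreover have "states canonical_frame - truth_set \<phi> = truth_set (\<^bold>\<not> \<phi>)"
    by (simp add: states truth_set_Neg)
  ultimately show ?case
    using Delta.prems by (simp add: truth_set_in_canonical_nbhd Delta_in_world_iff)
qed

text \<open>
  The empty set is consistent by definition, whatever the calculus proves, and any model satisfies
  it. A one-point frame without neighborhoods serves for that case and spares a proof that
  the calculus is consistent, on which the existence of states in the canonical model depends.
\<close>

theorem theorem19:
  shows "strongly_complete (R_Delta :: 'p fm set) (quasi_filters :: 'p fm set nframe set)"
  unfolding strongly_complete_def
proof (intro allI impI)
  fix \<Gamma> :: "'p fm set"
  assume \<Gamma>: "consistent R_Delta \<Gamma>"
  show "\<exists>F\<in>quasi_filters. \<exists>V. valuation F V \<and>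
      (\<exists>s\<in>states (F :: 'p fm set nframe). \<forall>\<phi>\<in>\<Gamma>. sat F V s \<phi>)"
  proof (cases "\<Gamma> = {}")
    case True
    define F :: "'p fm set nframe" where "F = \<lparr>states = {{}}, nbhd = \<lambda>_. {}\<rparr>"
    have "F \<in> quasi_filters"
      by (simp add: F_def quasi_filters_def nbhd_frame_def prop_m_def prop_c_def)
    moreover have "valuation F (\<lambda>_. {})" "{} \<in> states F"
      by (simp_all add: F_def valuation_def)
    ultimately show ?thesis
      using True by blast
  next
    case False
    with \<Gamma> obtain s where s: "s \<in> worlds" "\<Gamma> \<subseteq> s"
      by (rule Lindenbaum)
    have "(canonical_frame :: 'p fm set nframe) \<in> quasi_filters"
      using s(1) by (intro canonical_frame_quasi_filter) auto
    moreover have "valuation canonical_frame (canonical_valuation :: 'p \<Rightarrow> _)"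
      by (simp add: valuation_def canonical_frame_def canonical_valuation_def
          truth_set_subset_worlds)
    moreover have "s \<in> states canonical_frame"
      using s(1) by (simp add: canonical_frame_def)
    moreover have "\<forall>\<phi>\<in>\<Gamma>. sat canonical_frame canonical_valuation s \<phi>"
      using s by (auto simp: truth_lemma)
    ultimately show ?thesis by blast
  qed
qed

end
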